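(* Let $I\subset S=\mathbb{K}[x_1,\ldots,x_n]$ be a monomial ideal and let $I^p$ denote its polarization. Let $\mathcal{L}(I)$ and $\mathcal{L}(I^p)$ be the lcm-lattices of $I$ and $I^p$, respectively. Then $\mathcal{L}(I)\cong\mathcal{L}(I^p)$ (isomorphism of lattices).
   Context: $\mathbb{K}$ is a field. The lcm-lattice $\mathcal{L}(I)$ of a monomial ideal $I$ is the set of all least common multiples of subsets of the set of minimal monomial generators of $I$, partially ordered by divisibility; the empty subset contributes the minimal element $\hat 0=1$, and the maximal element $\hat 1$ is the lcm of all generators. Polarization: let $I=(u_1,\dots,u_m)$ with (minimal) monomial generators $u_j=x_1^{a_{1j}}x_2^{a_{2j}}\cdots x_n^{a_{nj}}$, and put $a_i=\max_j\{a_{ij}\}$. In the polynomial ring $S^p=\mathbb{K}[x_{i1},x_{i2},\ldots,x_{ia_i}\mid 1\le i\le n]$ set $u_j^p=\prod_{i=1}^n\prod_{k=1}^{a_{ij}}x_{ik}$. The polarization of $I$ is the square-free monomial ideal $I^p=(u_1^p,\ldots,u_m^p)\subseteq S^p$. *)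

theory Defs
  imports "HOL-Library.Poly_Mapping" "HOL-Algebra.Ideal" "HOL-Algebra.Divisibility" "HOL-Algebra.Lattice"
begin

text \<open>
  A polynomial over a field is a finitely supported map from exponent vectors to coefficients.
  Multiplication of \<open>\<Rightarrow>\<^sub>0\<close> is convolution, so the type carries the ring structure; since the
  variables of a polarization depend on the ideal, the ring \<open>K[x | x \<in> X]\<close> is realised as a
  carrier in this type.
\<close>

type_synonym ('x, 'k) mpoly = "('x \<Rightarrow>\<^sub>0 nat) \<Rightarrow>\<^sub>0 'k"

definition mpoly_ring :: "'x set \<Rightarrow> ('x, 'k::field) mpoly ring" where
  "mpoly_ring X =
     \<lparr>carrier = {p. \<forall>a \<in> Poly_Mapping.keys p. Poly_Mapping.keys a \<subseteq> X},
      monoid.mult = (*), one = 1, ring.zero = 0, add = (+)\<rparr>"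

definition monom_of :: "('x \<Rightarrow>\<^sub>0 nat) \<Rightarrow> ('x, 'k::field) mpoly" where
  "monom_of a = Poly_Mapping.single a 1"

definition var :: "'x \<Rightarrow> ('x, 'k::field) mpoly" where
  "var x = monom_of (Poly_Mapping.single x 1)"

definition monomials :: "'x set \<Rightarrow> ('x, 'k::field) mpoly set" where
  "monomials X = {monom_of a | a. Poly_Mapping.keys a \<subseteq> X}"

definition monomial_ideal :: "'x set \<Rightarrow> ('x, 'k::field) mpoly set \<Rightarrow> bool" where
  "monomial_ideal X I \<longleftrightarrow> (\<exists>A \<subseteq> monomials X. I = Idl\<^bsub>mpoly_ring X\<^esub> A)"

definition minimal_generating_set ::
    "'x set \<Rightarrow> ('x, 'k::field) mpoly set \<Rightarrow> ('x, 'k) mpoly set \<Rightarrow> bool" where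
  "minimal_generating_set X I G \<longleftrightarrow>
     G \<subseteq> monomials X \<and> Idl\<^bsub>mpoly_ring X\<^esub> G = I \<and> (\<forall>H. H \<subset> G \<longrightarrow> Idl\<^bsub>mpoly_ring X\<^esub> H \<noteq> I)"

text \<open>Well defined for monomial ideals by the lemma \<open>ex1_minimal_generating_set\<close> below.\<close>

definition min_gens :: "'x set \<Rightarrow> ('x, 'k::field) mpoly set \<Rightarrow> ('x, 'k) mpoly set" where
  "min_gens X I = (THE G. minimal_generating_set X I G)"

text \<open>
  A least common multiple is a least upper bound with respect to divisibility in the polynomial
  ring. It is unique only up to units; requiring it to be a monomial selects the monic one.
\<close>

definition monomial_lcms :: "'x set \<Rightarrow> ('x, 'k::field) mpoly set \<Rightarrow> ('x, 'k) mpoly set" where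
  "monomial_lcms X A =
     {u \<in> monomials X. least (division_rel (mpoly_ring X)) u (Upper (division_rel (mpoly_ring X)) A)}"

definition lcm_lattice :: "'x set \<Rightarrow> ('x, 'k::field) mpoly set \<Rightarrow> ('x, 'k) mpoly gorder" where
  "lcm_lattice X I =
     \<lparr>carrier = (\<Union>A \<in> Pow (min_gens X I). monomial_lcms X A),
      eq = (=),
      le = (divides\<^bsub>mpoly_ring X\<^esub>)\<rparr>"

text \<open>
  The set of minimal generators is finite by Dickson's lemma, so \<^const>\<open>Max\<close> is the genuine
  maximum. The element \<open>0\<close> is inserted so that it is \<open>0\<close> for the zero ideal.
\<close>

definition max_exponent :: "nat \<Rightarrow> (nat, 'k::field) mpoly set \<Rightarrow> nat \<Rightarrow> nat" where
  "max_exponent n I i = Max (insert 0 {Poly_Mapping.lookup a i | a. monom_of a \<in> min_gens {1..n} I})"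

text \<open>The variable \<open>x\<^bsub>ik\<^esub>\<close> of the polarization is indexed by the pair \<open>(i, k)\<close>.\<close>

definition polarization_vars :: "nat \<Rightarrow> (nat, 'k::field) mpoly set \<Rightarrow> (nat \<times> nat) set" where
  "polarization_vars n I = (SIGMA i:{1..n}. {1..max_exponent n I i})"

definition polarize_mono :: "nat \<Rightarrow> (nat \<Rightarrow>\<^sub>0 nat) \<Rightarrow> (nat \<times> nat, 'k::field) mpoly" where
  "polarize_mono n a = (\<Prod>i = 1..n. \<Prod>k = 1..Poly_Mapping.lookup a i. var (i, k))"

definition polarization ::
    "nat \<Rightarrow> (nat, 'k::field) mpoly set \<Rightarrow> (nat \<times> nat, 'k) mpoly set" where
  "polarization n I =
     Idl\<^bsub>mpoly_ring (polarization_vars n I)\<^esub> {polarize_mono n a | a. monom_of a \<in> min_gens {1..n} I}"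

definition lattice_isomorphic :: "('a, 'c) gorder_scheme \<Rightarrow> ('b, 'd) gorder_scheme \<Rightarrow> bool" where
  "lattice_isomorphic L M \<longleftrightarrow>
     (\<exists>f. bij_betw f (carrier L) (carrier M) \<and> join_pres L M f \<and> meet_pres L M f)"

subsection \<open>Existence and uniqueness of the minimal monomial generators\<close>

lemma cring_mpoly_ring: "cring (mpoly_ring X :: ('x, 'k::field) mpoly ring)"
proof (rule cringI)
  show "abelian_group (mpoly_ring X :: ('x, 'k) mpoly ring)"
  proof (rule abelian_groupI)
    fix x :: "('x, 'k) mpoly" assume "x \<in> carrier (mpoly_ring X)"
    then show "\<exists>y\<in>carrier (mpoly_ring X). y \<oplus>\<^bsub>mpoly_ring X\<^esub> x = \<zero>\<^bsub>mpoly_ring X\<^esub>"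
      by (intro bexI[of _ "- x"]) (auto simp: mpoly_ring_def)
  next
    fix x y :: "('x, 'k) mpoly"
    assume "x \<in> carrier (mpoly_ring X)" "y \<in> carrier (mpoly_ring X)"
    then show "x \<oplus>\<^bsub>mpoly_ring X\<^esub> y \<in> carrier (mpoly_ring X)"
      using keys_add[of x y] by (auto simp: mpoly_ring_def)
  qed (auto simp: mpoly_ring_def add_ac)
  show "comm_monoid (mpoly_ring X :: ('x, 'k) mpoly ring)"
  proof (rule comm_monoidI)
    fix x y :: "('x, 'k) mpoly"
    assume xy: "x \<in> carrier (mpoly_ring X)" "y \<in> carrier (mpoly_ring X)"
    have "Poly_Mapping.keys m \<subseteq> X" if m: "m \<in> Poly_Mapping.keys (x * y)" for m
    proof -
      obtain a b where ab: "m = a + b" "a \<in> Poly_Mapping.keys x" "b \<in> Poly_Mapping.keys y"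
        using keys_mult[of x y] m by blast
      with xy have "Poly_Mapping.keys a \<subseteq> X" "Poly_Mapping.keys b \<subseteq> X"
        by (auto simp: mpoly_ring_def)
      with ab(1) keys_add[of a b] show ?thesis by blast
    qed
    then show "x \<otimes>\<^bsub>mpoly_ring X\<^esub> y \<in> carrier (mpoly_ring X)"
      by (simp add: mpoly_ring_def)
  qed (auto simp: mpoly_ring_def mult_ac)
qed (auto simp: mpoly_ring_def algebra_simps)

lemma monom_of_mult: "monom_of a * monom_of b = monom_of (a + b)"
  by (simp add: monom_of_def mult_single)

lemma keys_monom_of [simp]: "Poly_Mapping.keys (monom_of a :: ('x, 'k::field) mpoly) = {a}"
  by (simp add: monom_of_def)

lemma monom_of_inject [simp]: "monom_of a = (monom_of b :: ('x, 'k::field) mpoly) \<longleftrightarrow> a = b"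
  using keys_monom_of by (metis singleton_inject)

lemma monomials_carrier: "monomials X \<subseteq> carrier (mpoly_ring X)"
  by (auto simp: monomials_def mpoly_ring_def)

lemma keys_summand: "Poly_Mapping.keys (c :: 'x \<Rightarrow>\<^sub>0 nat) \<subseteq> Poly_Mapping.keys (a + c)"
  by (auto simp: in_keys_iff lookup_add)

lemma monom_of_in_monomials_iff: "monom_of a \<in> monomials X \<longleftrightarrow> Poly_Mapping.keys a \<subseteq> X"
  by (auto simp: monomials_def)

lemma monom_of_divides_iff:
  assumes "Poly_Mapping.keys b \<subseteq> X"
  shows "monom_of a divides\<^bsub>mpoly_ring X\<^esub> (monom_of b :: ('x, 'k::field) mpoly) \<longleftrightarrow> (\<exists>c. b = a + c)"
proof
  assume "monom_of a divides\<^bsub>mpoly_ring X\<^esub> (monom_of b :: ('x, 'k::field) mpoly)"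
  then obtain q :: "('x, 'k) mpoly" where "monom_of b = monom_of a * q"
    by (auto simp: factor_def mpoly_ring_def)
  then have "Poly_Mapping.keys (monom_of a * q) = {b}"
    by (metis keys_monom_of)
  with keys_mult[of "monom_of a" q] show "\<exists>c. b = a + c"
    by auto
next
  assume "\<exists>c. b = a + c"
  then obtain c where c: "b = a + c" by blast
  with assms keys_summand[of c a] have "monom_of c \<in> carrier (mpoly_ring X)"
    by (auto simp: mpoly_ring_def)
  then show "monom_of a divides\<^bsub>mpoly_ring X\<^esub> (monom_of b :: ('x, 'k) mpoly)"
    unfolding factor_def using c monom_of_mult[of a c, where 'b='k]
    by (intro bexI[of _ "monom_of c"]) (auto simp: mpoly_ring_def)
qed

lemma keys_in_genideal:
  fixes A :: "('x, 'k::field) mpoly set"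
  assumes A: "A \<subseteq> monomials X" and p: "p \<in> Idl\<^bsub>mpoly_ring X\<^esub> A" and m: "m \<in> Poly_Mapping.keys p"
  shows "\<exists>a c. monom_of a \<in> A \<and> m = a + c"
proof -
  interpret cring "mpoly_ring X :: ('x, 'k) mpoly ring" by (rule cring_mpoly_ring)
  let ?J = "{p :: ('x, 'k) mpoly. p \<in> carrier (mpoly_ring X) \<and>
      (\<forall>m\<in>Poly_Mapping.keys p. \<exists>a c. monom_of a \<in> A \<and> m = a + c)}"
  have "ideal ?J (mpoly_ring X)"
  proof (rule idealI[OF cring.axioms(1)[OF cring_mpoly_ring]])
    show "subgroup ?J (add_monoid (mpoly_ring X))"
    proof (rule add.subgroupI)
      fix x assume x: "x \<in> ?J"
      have "\<ominus>\<^bsub>mpoly_ring X\<^esub> x = - x"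
        using x by (intro minus_equality) (auto simp: mpoly_ring_def)
      with x show "\<ominus>\<^bsub>mpoly_ring X\<^esub> x \<in> ?J"
        by (auto simp: mpoly_ring_def)
    next
      fix x y assume xy: "x \<in> ?J" "y \<in> ?J"
      then have "x \<oplus>\<^bsub>mpoly_ring X\<^esub> y \<in> carrier (mpoly_ring X)" by auto
      moreover have "Poly_Mapping.keys (x \<oplus>\<^bsub>mpoly_ring X\<^esub> y) \<subseteq> Poly_Mapping.keys x \<union> Poly_Mapping.keys y"
        using keys_add[of x y] by (simp add: mpoly_ring_def)
      ultimately show "x \<oplus>\<^bsub>mpoly_ring X\<^esub> y \<in> ?J" using xy by blast
    next
      have "0 \<in> ?J" by (simp add: mpoly_ring_def)
      then show "?J \<noteq> {}" by blast
    qed auto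
  next
    fix x y :: "('x, 'k) mpoly" assume xy: "x \<in> ?J" "y \<in> carrier (mpoly_ring X)"
    have "\<exists>a c. monom_of a \<in> A \<and> m = a + c" if m: "m \<in> Poly_Mapping.keys (x * y)" for m
    proof -
      obtain s t where "s \<in> Poly_Mapping.keys x" "m = s + t"
        using keys_mult[of x y] m by auto
      moreover from this xy obtain a c where "monom_of a \<in> A" "s = a + c" by auto
      ultimately show ?thesis by (metis add.assoc)
    qed
    moreover have "x \<otimes>\<^bsub>mpoly_ring X\<^esub> y \<in> carrier (mpoly_ring X)" using xy by auto
    ultimately show *: "x \<otimes>\<^bsub>mpoly_ring X\<^esub> y \<in> ?J" by (auto simp: mpoly_ring_def)
    show "y \<otimes>\<^bsub>mpoly_ring X\<^esub> x \<in> ?J" using * xy m_comm[of x y] by auto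
  qed
  moreover have "A \<subseteq> ?J"
  proof
    fix u assume u: "u \<in> A"
    then obtain a where "u = monom_of a" using A by (auto simp: monomials_def)
    moreover have "u \<in> carrier (mpoly_ring X)"
      using u A monomials_carrier by blast
    ultimately show "u \<in> ?J"
      using u by (auto intro: exI[of _ a] simp: exI[of "\<lambda>c. a = a + c" 0])
  qed
  ultimately have "Idl\<^bsub>mpoly_ring X\<^esub> A \<subseteq> ?J" by (rule genideal_minimal)
  with p m show ?thesis by auto
qed

lemma monom_of_in_genideal_iff:
  fixes A :: "('x, 'k::field) mpoly set"
  assumes A: "A \<subseteq> monomials X" and b: "Poly_Mapping.keys b \<subseteq> X"
  shows "monom_of b \<in> Idl\<^bsub>mpoly_ring X\<^esub> A \<longleftrightarrow> (\<exists>a c. monom_of a \<in> A \<and> b = a + c)"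
proof
  assume "monom_of b \<in> Idl\<^bsub>mpoly_ring X\<^esub> A"
  from keys_in_genideal[OF A this] show "\<exists>a c. monom_of a \<in> A \<and> b = a + c" by simp
next
  interpret cring "mpoly_ring X :: ('x, 'k) mpoly ring" by (rule cring_mpoly_ring)
  assume "\<exists>a c. monom_of a \<in> A \<and> b = a + c"
  then obtain a c where ac: "monom_of a \<in> A" "b = a + c" by blast
  have AX: "A \<subseteq> carrier (mpoly_ring X)" using A monomials_carrier by blast
  interpret I: ideal "Idl\<^bsub>mpoly_ring X\<^esub> A" "mpoly_ring X" by (rule genideal_ideal[OF AX])
  have "monom_of c \<in> carrier (mpoly_ring X)"
    using ac b keys_summand[of c a] by (auto simp: mpoly_ring_def)
  then have "monom_of a \<otimes>\<^bsub>mpoly_ring X\<^esub> monom_of c \<in> Idl\<^bsub>mpoly_ring X\<^esub> A"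
    using ac genideal_self[OF AX] by (intro I.I_r_closed) auto
  then show "monom_of b \<in> Idl\<^bsub>mpoly_ring X\<^esub> A"
    using ac monom_of_mult[of a c, where 'b='k] by (simp add: mpoly_ring_def)
qed

lemma genideal_monomials_subset:
  fixes A B :: "('x, 'k::field) mpoly set"
  assumes "A \<subseteq> monomials X" "B \<subseteq> monomials X"
    and "\<And>a. monom_of a \<in> A \<Longrightarrow> \<exists>b c. monom_of b \<in> B \<and> a = b + c"
  shows "Idl\<^bsub>mpoly_ring X\<^esub> A \<subseteq> Idl\<^bsub>mpoly_ring X\<^esub> B"
proof -
  interpret cring "mpoly_ring X :: ('x, 'k) mpoly ring" by (rule cring_mpoly_ring)
  have "A \<subseteq> Idl\<^bsub>mpoly_ring X\<^esub> B"
  proof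
    fix u assume u: "u \<in> A"
    then obtain a where a: "u = monom_of a" "Poly_Mapping.keys a \<subseteq> X"
      using assms(1) by (auto simp: monomials_def)
    then show "u \<in> Idl\<^bsub>mpoly_ring X\<^esub> B"
      using u assms(3)[of a] monom_of_in_genideal_iff[OF assms(2), of a] by auto
  qed
  moreover have "ideal (Idl\<^bsub>mpoly_ring X\<^esub> B) (mpoly_ring X)"
    using assms(2) monomials_carrier by (intro genideal_ideal) blast
  ultimately show ?thesis by (intro genideal_minimal)
qed

definition min_exponents :: "'x set \<Rightarrow> ('x, 'k::field) mpoly set \<Rightarrow> ('x \<Rightarrow>\<^sub>0 nat) set" where
  "min_exponents X I = {b. Poly_Mapping.keys b \<subseteq> X \<and> monom_of b \<in> I \<and> (\<forall>a c. monom_of a \<in> I \<and> b = a + c \<longrightarrow> c = 0)}"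

lemma min_exponents_below:
  assumes "Poly_Mapping.keys b \<subseteq> X" "monom_of b \<in> I"
  shows "\<exists>a c. a \<in> min_exponents X I \<and> b = a + c"
  using assms
proof (induction "\<Sum>x\<in>Poly_Mapping.keys b. Poly_Mapping.lookup b x" arbitrary: b rule: less_induct)
  case less
  show ?case
  proof (cases "b \<in> min_exponents X I")
    case True
    then show ?thesis by (intro exI[of _ b] exI[of _ 0]) simp
  next
    case False
    then obtain a c where ac: "monom_of a \<in> I" "b = a + c" "c \<noteq> 0"
      using less.prems by (auto simp: min_exponents_def)
    have sub: "Poly_Mapping.keys a \<subseteq> Poly_Mapping.keys b"
      using ac(2) by (auto simp: in_keys_iff lookup_add)
    obtain x where x: "Poly_Mapping.lookup c x \<noteq> 0"
      using ac(3) by (auto simp: poly_mapping_eq_iff fun_eq_iff)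
    have "(\<Sum>x\<in>Poly_Mapping.keys a. Poly_Mapping.lookup a x) = (\<Sum>x\<in>Poly_Mapping.keys b. Poly_Mapping.lookup a x)"
      using sub by (intro sum.mono_neutral_left) (auto simp: in_keys_iff)
    also have "\<dots> < (\<Sum>x\<in>Poly_Mapping.keys b. Poly_Mapping.lookup b x)"
      using x ac(2) by (intro sum_strict_mono_ex1) (auto simp: lookup_add in_keys_iff)
    finally obtain a' c' where "a' \<in> min_exponents X I" "a = a' + c'"
      using less.hyps[of a] sub less.prems(1) ac(1) by blast
    then show ?thesis using ac(2) by (metis add.assoc)
  qed
qed

lemma ex1_minimal_generating_set:
  fixes I :: "('x, 'k::field) mpoly set"
  assumes "monomial_ideal X I"
  shows "\<exists>!G. minimal_generating_set X I G"
proof -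
  obtain A where A: "A \<subseteq> monomials X" "I = Idl\<^bsub>mpoly_ring X\<^esub> A"
    using assms by (auto simp: monomial_ideal_def)
  interpret cring "mpoly_ring X :: ('x, 'k) mpoly ring" by (rule cring_mpoly_ring)
  let ?M = "monom_of ` min_exponents X I :: ('x, 'k) mpoly set"
  have inI: "G \<subseteq> Idl\<^bsub>mpoly_ring X\<^esub> G" if "G \<subseteq> monomials X" for G :: "('x, 'k) mpoly set"
    using that monomials_carrier by (intro genideal_self) blast
  have M: "?M \<subseteq> monomials X" by (auto simp: min_exponents_def monomials_def)
  have gen: "Idl\<^bsub>mpoly_ring X\<^esub> ?M = I"
  proof
    show "Idl\<^bsub>mpoly_ring X\<^esub> ?M \<subseteq> I" unfolding A(2)
    proof (rule genideal_monomials_subset)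
      fix a assume "monom_of a \<in> (monom_of ` min_exponents X (Idl\<^bsub>mpoly_ring X\<^esub> A) :: ('x, 'k) mpoly set)"
      then have "Poly_Mapping.keys a \<subseteq> X" "monom_of a \<in> Idl\<^bsub>mpoly_ring X\<^esub> A"
        by (auto simp: min_exponents_def)
      then show "\<exists>b c. monom_of b \<in> A \<and> a = b + c"
        using monom_of_in_genideal_iff[OF A(1)] by blast
    qed (use M A in simp_all)
    show "I \<subseteq> Idl\<^bsub>mpoly_ring X\<^esub> ?M" unfolding A(2)
    proof (rule genideal_monomials_subset)
      fix a assume "monom_of a \<in> A"
      then have "Poly_Mapping.keys a \<subseteq> X" "(monom_of a :: ('x, 'k) mpoly) \<in> Idl\<^bsub>mpoly_ring X\<^esub> A"
        using subsetD[OF A(1)] subsetD[OF inI[OF A(1)]]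
          iffD1[OF monom_of_in_monomials_iff[of a X, where 'b='k]] by simp_all
      then show "\<exists>b c. monom_of b \<in> (monom_of ` min_exponents X (Idl\<^bsub>mpoly_ring X\<^esub> A) :: ('x, 'k) mpoly set)
          \<and> a = b + c"
        by (meson min_exponents_below imageI)
    qed (use M A in simp_all)
  qed
  have minM: "Idl\<^bsub>mpoly_ring X\<^esub> H \<noteq> I" if H: "H \<subset> ?M" for H
  proof
    assume HI: "Idl\<^bsub>mpoly_ring X\<^esub> H = I"
    have HX: "H \<subseteq> monomials X" using H M by blast
    obtain b where b: "b \<in> min_exponents X I" "monom_of b \<notin> H" using H by blast
    then have "Poly_Mapping.keys b \<subseteq> X" "monom_of b \<in> Idl\<^bsub>mpoly_ring X\<^esub> H"
      using HI by (auto simp: min_exponents_def)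
    then obtain a c where ac: "monom_of a \<in> H" "b = a + c"
      using monom_of_in_genideal_iff[OF HX] by blast
    then have "c = 0"
      using b(1) inI[OF HX] HI by (auto simp: min_exponents_def)
    with ac b show False by simp
  qed
  show ?thesis
  proof (rule ex1I[of _ ?M])
    show "minimal_generating_set X I ?M"
      using M gen minM by (auto simp: minimal_generating_set_def)
  next
    fix G assume "minimal_generating_set X I G"
    then have G: "G \<subseteq> monomials X" "Idl\<^bsub>mpoly_ring X\<^esub> G = I"
      and minG: "\<And>H. H \<subset> G \<Longrightarrow> Idl\<^bsub>mpoly_ring X\<^esub> H \<noteq> I"
      by (auto simp: minimal_generating_set_def)
    have "?M \<subseteq> G"
    proof
      fix u assume "u \<in> ?M"
      then obtain b where b: "u = monom_of b" "b \<in> min_exponents X I" by blast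
      then have "Poly_Mapping.keys b \<subseteq> X" "monom_of b \<in> Idl\<^bsub>mpoly_ring X\<^esub> G"
        using G(2) by (auto simp: min_exponents_def)
      then obtain a c where ac: "monom_of a \<in> G" "b = a + c"
        using monom_of_in_genideal_iff[OF G(1)] by blast
      then have "c = 0"
        using b(2) inI[OF G(1)] G(2) by (auto simp: min_exponents_def)
      with ac b show "u \<in> G" by simp
    qed
    with minG gen show "G = ?M" by blast
  qed
qed

end

theory Submission
  imports Defs
begin

text \<open>
  A monomial ideal has a unique minimal set of monomial generators, and their exponent vectors form
  an antichain \<open>E\<close> for the componentwise order; by Dickson's lemma \<open>E\<close> is finite. Since a monomial
  \<open>x\<^sup>a\<close> divides a polynomial exactly if it divides each of its terms
  (\<open>monom_of_divides_iff_keys\<close>), the lcm of monomials in the polynomial ring is the monomial whose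
  exponent vector is the componentwise maximum (\<open>monomial_lcms_eq\<close>). The lcm-lattice is therefore
  the set of componentwise maxima of subsets of \<open>E\<close>, ordered componentwise.

  Polarization acts on exponent vectors by replacing the number \<open>a\<^sub>i\<close> with the initial segment
  \<open>{(i,1), \<dots>, (i,a\<^sub>i)}\<close>. Initial segments are nested just as their lengths are ordered, and the union
  of several of them is the one of maximal length. So polarization \<open>P\<close> is an order embedding
  (\<open>polarize_exponent_le_iff\<close>) that commutes with finite componentwise maxima
  (\<open>polarize_exponent_lcm\<close>). The first property makes \<open>P ` E\<close> an antichain again, hence the set of
  minimal generators of the polarized ideal; the second makes \<open>P\<close> map \<open>lcm A\<close> to \<open>lcm (P ` A)\<close>, which
  gives a bijection between the two lcm-lattices. A bijection that preserves and reflects the order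
  preserves joins and meets.
\<close>

section \<open>Divisibility of exponent vectors\<close>

definition exponent_le :: "('x \<Rightarrow>\<^sub>0 nat) \<Rightarrow> ('x \<Rightarrow>\<^sub>0 nat) \<Rightarrow> bool" (infix "\<preceq>" 50) where
  "a \<preceq> b \<longleftrightarrow> (\<forall>x. Poly_Mapping.lookup a x \<le> Poly_Mapping.lookup b x)"

lemma exponent_le_refl: "a \<preceq> a"
  by (simp add: exponent_le_def)

lemma exponent_le_trans: "a \<preceq> b \<Longrightarrow> b \<preceq> c \<Longrightarrow> a \<preceq> c"
  unfolding exponent_le_def by (meson le_trans)

lemma exponent_le_antisym: "a \<preceq> b \<Longrightarrow> b \<preceq> a \<Longrightarrow> a = b"
  by (auto simp: exponent_le_def intro!: poly_mapping_eqI le_antisym)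

lemma exponent_le_iff_add: "a \<preceq> b \<longleftrightarrow> (\<exists>c. b = a + c)"
proof
  assume "a \<preceq> b"
  then have "b = a + (b - a)"
    by (auto simp: exponent_le_def lookup_add lookup_minus intro!: poly_mapping_eqI)
  then show "\<exists>c. b = a + c" ..
qed (auto simp: exponent_le_def lookup_add)

lemma exponent_le_keys: "a \<preceq> b \<Longrightarrow> Poly_Mapping.keys a \<subseteq> Poly_Mapping.keys b"
  by (metis exponent_le_iff_add add.commute keys_summand)

text \<open>
  Multiplication by a monomial shifts exponent vectors, so a monomial that divides every term of
  \<open>p\<close> can be cancelled from \<open>p\<close> term by term. The statement for arbitrary \<open>p\<close> is needed because a
  least common multiple has to divide all common multiples in the ring, not only the monomial ones.
\<close>

lemma monom_of_divides_iff_keys: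
  fixes p :: "('x, 'k::field) mpoly"
  assumes p: "p \<in> carrier (mpoly_ring X)"
  shows "monom_of a divides\<^bsub>mpoly_ring X\<^esub> p \<longleftrightarrow> (\<forall>m\<in>Poly_Mapping.keys p. a \<preceq> m)"
proof
  assume "monom_of a divides\<^bsub>mpoly_ring X\<^esub> p"
  then obtain q where "p = monom_of a * q"
    by (auto simp: factor_def mpoly_ring_def)
  then show "\<forall>m\<in>Poly_Mapping.keys p. a \<preceq> m"
    using keys_mult[of "monom_of a" q] by (auto simp: exponent_le_iff_add)
next
  assume le: "\<forall>m\<in>Poly_Mapping.keys p. a \<preceq> m"
  define q where "q = (\<Sum>m\<in>Poly_Mapping.keys p. Poly_Mapping.single (m - a) (Poly_Mapping.lookup p m))"
  have "monom_of a * q = (\<Sum>m\<in>Poly_Mapping.keys p. Poly_Mapping.single m (Poly_Mapping.lookup p m))"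
    unfolding q_def sum_distrib_left
  proof (rule sum.cong[OF refl])
    fix m assume "m \<in> Poly_Mapping.keys p"
    with le have "a + (m - a) = m"
      by (auto simp: exponent_le_iff_add)
    then show "monom_of a * Poly_Mapping.single (m - a) (Poly_Mapping.lookup p m)
        = Poly_Mapping.single m (Poly_Mapping.lookup p m)"
      by (simp add: monom_of_def mult_single)
  qed
  also have "\<dots> = p"
    by (rule poly_mapping_eqI)
      (simp add: lookup_sum lookup_single when_def in_keys_iff)
  finally have "p = monom_of a * q" ..
  moreover have "Poly_Mapping.keys s \<subseteq> X" if "s \<in> Poly_Mapping.keys q" for s
  proof -
    obtain m where "m \<in> Poly_Mapping.keys p"
      and "Poly_Mapping.lookup (Poly_Mapping.single (m - a) (Poly_Mapping.lookup p m)) s \<noteq> 0"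
      using \<open>s \<in> Poly_Mapping.keys q\<close> unfolding q_def in_keys_iff lookup_sum
      by (meson sum.not_neutral_contains_not_neutral in_keys_iff)
    then have "m \<in> Poly_Mapping.keys p" "s = m - a"
      by (auto simp: lookup_single when_def split: if_splits)
    moreover from this le have "s \<preceq> m"
      by (auto simp: exponent_le_def lookup_minus)
    ultimately show ?thesis
      using exponent_le_keys p by (fastforce simp: mpoly_ring_def)
  qed
  ultimately show "monom_of a divides\<^bsub>mpoly_ring X\<^esub> p"
    by (auto simp: factor_def mpoly_ring_def)
qed

lemma monom_of_divides_monom_of:
  assumes "Poly_Mapping.keys b \<subseteq> X"
  shows "monom_of a divides\<^bsub>mpoly_ring X\<^esub> (monom_of b :: ('x, 'k::field) mpoly) \<longleftrightarrow> a \<preceq> b"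
  using monom_of_divides_iff[OF assms] exponent_le_iff_add by blast

section \<open>Least common multiples of monomials\<close>

text \<open>Inserting \<open>0\<close> makes the lcm of the empty set the zero vector, that is, the monomial \<open>1\<close>.\<close>

definition exponent_lcm :: "('x \<Rightarrow>\<^sub>0 nat) set \<Rightarrow> 'x \<Rightarrow>\<^sub>0 nat" where
  "exponent_lcm A = Abs_poly_mapping (\<lambda>x. Max (insert 0 ((\<lambda>a. Poly_Mapping.lookup a x) ` A)))"

lemma lookup_exponent_lcm:
  assumes "finite A"
  shows "Poly_Mapping.lookup (exponent_lcm A) x = Max (insert 0 ((\<lambda>a. Poly_Mapping.lookup a x) ` A))"
proof -
  define g where "g x = Max (insert 0 ((\<lambda>a. Poly_Mapping.lookup a x) ` A))" for x
  have "g x = 0" if "x \<notin> (\<Union>a\<in>A. Poly_Mapping.keys a)" for x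
  proof -
    have zero: "insert 0 ((\<lambda>a. Poly_Mapping.lookup a x) ` A) = {0}"
      using that by (auto simp: in_keys_iff)
    show ?thesis unfolding g_def zero by simp
  qed
  then have "{x. g x \<noteq> 0} \<subseteq> (\<Union>a\<in>A. Poly_Mapping.keys a)"
    by (intro subsetI) (metis (mono_tags) mem_Collect_eq)
  then have "finite {x. g x \<noteq> 0}"
    by (rule finite_subset) (simp add: assms)
  then show ?thesis
    by (simp add: exponent_lcm_def Abs_poly_mapping_inverse flip: g_def)
qed

lemma exponent_lcm_le_iff:
  "finite A \<Longrightarrow> exponent_lcm A \<preceq> b \<longleftrightarrow> (\<forall>a\<in>A. a \<preceq> b)"
  by (auto simp: exponent_le_def lookup_exponent_lcm)

lemma le_exponent_lcm: "finite A \<Longrightarrow> a \<in> A \<Longrightarrow> a \<preceq> exponent_lcm A"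
  using exponent_lcm_le_iff exponent_le_refl by blast

lemma exponent_lcm_mono:
  "finite B \<Longrightarrow> A \<subseteq> B \<Longrightarrow> exponent_lcm A \<preceq> exponent_lcm B"
  by (meson exponent_lcm_le_iff finite_subset le_exponent_lcm subsetD)

lemma keys_exponent_lcm:
  assumes "finite A" "\<And>a. a \<in> A \<Longrightarrow> Poly_Mapping.keys a \<subseteq> X"
  shows "Poly_Mapping.keys (exponent_lcm A) \<subseteq> X"
proof
  fix x assume "x \<in> Poly_Mapping.keys (exponent_lcm A)"
  then have "0 < Max (insert 0 ((\<lambda>a. Poly_Mapping.lookup a x) ` A))"
    using assms by (simp add: in_keys_iff lookup_exponent_lcm)
  then obtain a where "a \<in> A" "Poly_Mapping.lookup a x \<noteq> 0"
    using assms(1) by (subst (asm) Max_gr_iff) auto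
  then show "x \<in> X" using assms(2)[of a] by (auto simp: in_keys_iff)
qed

text \<open>
  A polynomial is a common multiple of the monomials in \<open>A\<close> iff each of its exponent vectors lies
  above all of \<open>A\<close>, hence above their componentwise maximum; so the maximum divides every common
  multiple. Two monomials that divide each other are equal, which gives uniqueness.
\<close>

lemma monomial_lcms_eq:
  assumes fin: "finite A" and keys: "\<And>a. a \<in> A \<Longrightarrow> Poly_Mapping.keys a \<subseteq> X"
  shows "monomial_lcms X (monom_of ` A) = {monom_of (exponent_lcm A) :: ('x, 'k::field) mpoly}"
proof -
  let ?R = "mpoly_ring X :: ('x, 'k) mpoly ring"
  let ?M = "monom_of ` A :: ('x, 'k) mpoly set"
  let ?U = "Upper (division_rel ?R) ?M"
  have lX: "Poly_Mapping.keys (exponent_lcm A) \<subseteq> X"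
    using keys_exponent_lcm[OF fin keys] .
  have mem: "?M \<subseteq> carrier ?R"
    using keys by (fastforce simp: mpoly_ring_def)
  have U: "?U = {p \<in> carrier ?R. \<forall>m\<in>Poly_Mapping.keys p. exponent_lcm A \<preceq> m}"
    using mem by (auto simp: Upper_def monom_of_divides_iff_keys exponent_lcm_le_iff[OF fin] image_subset_iff)
  have least: "least (division_rel ?R) u ?U \<longleftrightarrow> u \<in> ?U \<and> (\<forall>p\<in>?U. u divides\<^bsub>?R\<^esub> p)" for u
    by (auto simp: least_def Upper_def)
  have lU: "monom_of (exponent_lcm A) \<in> ?U"
    using lX by (simp add: U exponent_le_refl) (simp add: mpoly_ring_def)
  have "monom_of (exponent_lcm A) \<in> monomial_lcms X ?M"
    using lX lU by (auto simp: monomial_lcms_def least monom_of_in_monomials_iff)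
      (auto simp: U monom_of_divides_iff_keys)
  moreover have "u = monom_of (exponent_lcm A)" if u: "u \<in> monomial_lcms X ?M" for u
  proof -
    obtain m where m: "u = monom_of m" "Poly_Mapping.keys m \<subseteq> X" "u \<in> ?U" "\<forall>p\<in>?U. u divides\<^bsub>?R\<^esub> p"
      using u by (auto simp: monomial_lcms_def monomials_def least)
    then have "exponent_lcm A \<preceq> m" by (auto simp: U)
    moreover have "m \<preceq> exponent_lcm A"
      using m lU monom_of_divides_monom_of[OF lX] by blast
    ultimately show ?thesis using exponent_le_antisym m(1) by blast
  qed
  ultimately show ?thesis by blast
qed

section \<open>Minimal generators\<close>

definition antichain_exponents :: "'x set \<Rightarrow> ('x \<Rightarrow>\<^sub>0 nat) set \<Rightarrow> bool" where
  "antichain_exponents X E \<longleftrightarrow>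
     (\<forall>a\<in>E. Poly_Mapping.keys a \<subseteq> X) \<and> (\<forall>a\<in>E. \<forall>b\<in>E. a \<preceq> b \<longrightarrow> a = b)"

text \<open>
  Dickson's lemma, by induction on the set of coordinates. Take a finite basis \<open>B\<close> for the order
  that ignores the new coordinate \<open>x\<close>, and let \<open>N\<close> bound the \<open>x\<close>-values on \<open>B\<close>. Elements whose
  \<open>x\<close>-value is at least \<open>N\<close> lie above an element of \<open>B\<close> in all coordinates. The others fall into
  the finitely many slices of constant \<open>x\<close>-value \<open>k < N\<close>, and each slice has a finite basis, since
  \<open>x\<close> does not distinguish its elements.
\<close>

lemma dickson_finite_basis:
  fixes f :: "'a \<Rightarrow> 'x \<Rightarrow> nat"
  assumes "finite X"
  shows "\<exists>B\<subseteq>A. finite B \<and> (\<forall>a\<in>A. \<exists>b\<in>B. \<forall>x\<in>X. f b x \<le> f a x)"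
  using assms
proof (induction X arbitrary: A rule: finite_induct)
  case empty
  then show ?case
  proof (cases "A = {}")
    case False
    then obtain a where "a \<in> A" by blast
    then show ?thesis by (intro exI[of _ "{a}"]) auto
  qed auto
next
  case (insert x X)
  obtain B where B: "B \<subseteq> A" "finite B" "\<And>a. a \<in> A \<Longrightarrow> \<exists>b\<in>B. \<forall>y\<in>X. f b y \<le> f a y"
    using insert.IH[of A] by blast
  obtain C where C: "\<And>k. C k \<subseteq> {a \<in> A. f a x = k}" "\<And>k. finite (C k)"
    "\<And>k a. a \<in> A \<Longrightarrow> f a x = k \<Longrightarrow> \<exists>b\<in>C k. \<forall>y\<in>X. f b y \<le> f a y"
    using insert.IH[of "{a \<in> A. f a x = _}"] by (simp add: Ball_def) metis
  define N where "N = Max (insert 0 ((\<lambda>b. f b x) ` B))"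
  have N: "f b x \<le> N" if "b \<in> B" for b
    using that B(2) by (simp add: N_def)
  have "\<exists>b\<in>B \<union> (\<Union>k<N. C k). \<forall>y\<in>insert x X. f b y \<le> f a y" if a: "a \<in> A" for a
  proof (cases "f a x < N")
    case True
    obtain b where b: "b \<in> C (f a x)" "\<forall>y\<in>X. f b y \<le> f a y"
      using C(3)[OF a refl] by blast
    with C(1)[of "f a x"] True show ?thesis
      by (intro bexI[of _ b]) auto
  next
    case False
    obtain b where "b \<in> B" "\<forall>y\<in>X. f b y \<le> f a y"
      using B(3)[OF a] by blast
    with N[of b] False show ?thesis
      by (intro bexI[of _ b]) auto
  qed
  moreover have "B \<union> (\<Union>k<N. C k) \<subseteq> A" "finite (B \<union> (\<Union>k<N. C k))"
    using B(1,2) C(2) UN_least[of "{..<N}" C A] C(1) by auto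
  ultimately show ?case by (intro exI[of _ "B \<union> (\<Union>k<N. C k)"]) auto
qed

lemma finite_antichain_exponents:
  assumes "finite X" "antichain_exponents X E"
  shows "finite E"
proof -
  obtain B where B: "B \<subseteq> E" "finite B"
    "\<And>a. a \<in> E \<Longrightarrow> \<exists>b\<in>B. \<forall>x\<in>X. Poly_Mapping.lookup b x \<le> Poly_Mapping.lookup a x"
    using dickson_finite_basis[OF assms(1), of E Poly_Mapping.lookup] by blast
  have "a \<in> B" if a: "a \<in> E" for a
  proof -
    obtain b where b: "b \<in> B" "\<forall>x\<in>X. Poly_Mapping.lookup b x \<le> Poly_Mapping.lookup a x"
      using B(3)[OF a] by blast
    then have "Poly_Mapping.keys b \<subseteq> X"
      using B(1) assms(2) by (auto simp: antichain_exponents_def)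
    with b(2) have "b \<preceq> a"
      unfolding exponent_le_def by (metis in_keys_iff le0 subsetD)
    with a b B(1) assms(2) show ?thesis
      by (auto simp: antichain_exponents_def)
  qed
  with B(2) show ?thesis by (meson finite_subset subsetI)
qed

text \<open>
  A monomial lies in a monomial ideal only if some generator divides it. In an antichain this
  generator has to be the monomial itself, so no member can be left out.
\<close>

lemma minimal_generating_set_antichain:
  assumes "antichain_exponents X E"
  shows "minimal_generating_set X (Idl\<^bsub>mpoly_ring X\<^esub> (monom_of ` E)) (monom_of ` E :: ('x, 'k::field) mpoly set)"
proof -
  let ?G = "monom_of ` E :: ('x, 'k) mpoly set"
  interpret cring "mpoly_ring X :: ('x, 'k) mpoly ring" by (rule cring_mpoly_ring)
  have G: "?G \<subseteq> monomials X"
    using assms by (auto simp: antichain_exponents_def monomials_def)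
  have "Idl\<^bsub>mpoly_ring X\<^esub> H \<noteq> Idl\<^bsub>mpoly_ring X\<^esub> ?G" if H: "H \<subset> ?G" for H
  proof
    assume eq: "Idl\<^bsub>mpoly_ring X\<^esub> H = Idl\<^bsub>mpoly_ring X\<^esub> ?G"
    obtain b where b: "b \<in> E" "monom_of b \<notin> H"
      using H by blast
    have "?G \<subseteq> Idl\<^bsub>mpoly_ring X\<^esub> ?G"
      using G monomials_carrier by (intro genideal_self) blast
    with b(1) eq have "monom_of b \<in> Idl\<^bsub>mpoly_ring X\<^esub> H" by auto
    moreover have "H \<subseteq> monomials X" "Poly_Mapping.keys b \<subseteq> X"
      using H G b(1) assms by (auto simp: antichain_exponents_def)
    ultimately obtain a where a: "monom_of a \<in> H" "a \<preceq> b"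
      using monom_of_in_genideal_iff exponent_le_iff_add by metis
    then have "a \<in> E" using H by auto
    then have "a = b"
      using a(2) b(1) assms by (auto simp: antichain_exponents_def)
    with a(1) b(2) show False by simp
  qed
  then show ?thesis using G by (auto simp: minimal_generating_set_def)
qed

lemma monomial_ideal_genideal:
  "antichain_exponents X E \<Longrightarrow> monomial_ideal X (Idl\<^bsub>mpoly_ring X\<^esub> (monom_of ` E :: ('x, 'k::field) mpoly set))"
  using minimal_generating_set_antichain
  by (auto simp: monomial_ideal_def minimal_generating_set_def)

lemma min_gens_genideal_antichain:
  assumes "antichain_exponents X E"
  shows "min_gens X (Idl\<^bsub>mpoly_ring X\<^esub> (monom_of ` E)) = (monom_of ` E :: ('x, 'k::field) mpoly set)"
  unfolding min_gens_def
  by (rule the1_equality[OF ex1_minimal_generating_set[OF monomial_ideal_genideal[OF assms]]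
        minimal_generating_set_antichain[OF assms]])

text \<open>
  Conversely, minimal generators form an antichain, since a generator divisible by another one is
  redundant.
\<close>

lemma min_gens_antichain:
  fixes I :: "('x, 'k::field) mpoly set"
  assumes "monomial_ideal X I"
  obtains E where "antichain_exponents X E" "min_gens X I = monom_of ` E"
proof -
  have "minimal_generating_set X I (min_gens X I)"
    unfolding min_gens_def by (rule theI'[OF ex1_minimal_generating_set[OF assms]])
  then have G: "min_gens X I \<subseteq> monomials X" "Idl\<^bsub>mpoly_ring X\<^esub> (min_gens X I) = I"
    and min: "\<And>H. H \<subset> min_gens X I \<Longrightarrow> Idl\<^bsub>mpoly_ring X\<^esub> H \<noteq> I"
    by (auto simp: minimal_generating_set_def)
  define E where "E = {a. (monom_of a :: ('x, 'k) mpoly) \<in> min_gens X I}"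
  have GE: "min_gens X I = monom_of ` E"
    using G(1) by (auto simp: E_def monomials_def)
  have "a = b" if ab: "a \<in> E" "b \<in> E" "a \<preceq> b" for a b
  proof (rule ccontr)
    assume "a \<noteq> b"
    let ?H = "min_gens X I - {monom_of b}"
    have "\<exists>a c. monom_of a \<in> ?H \<and> d = a + c" if "monom_of d \<in> min_gens X I" for d
    proof (cases "d = b")
      case True
      with ab \<open>a \<noteq> b\<close> show ?thesis
        by (auto simp: E_def exponent_le_iff_add)
    next
      case False
      with that show ?thesis by (intro exI[of _ d] exI[of _ 0]) auto
    qed
    then have "Idl\<^bsub>mpoly_ring X\<^esub> (min_gens X I) \<subseteq> Idl\<^bsub>mpoly_ring X\<^esub> ?H"
      using G(1) by (intro genideal_monomials_subset) auto
    moreover have "Idl\<^bsub>mpoly_ring X\<^esub> ?H \<subseteq> Idl\<^bsub>mpoly_ring X\<^esub> (min_gens X I)"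
      using G(1) by (intro genideal_monomials_subset) (auto intro: exI[of _ 0])
    ultimately have "Idl\<^bsub>mpoly_ring X\<^esub> ?H = I" using G(2) by simp
    moreover have "?H \<subset> min_gens X I" using ab(2) by (auto simp: E_def)
    ultimately show False using min by blast
  qed
  moreover have "\<forall>a\<in>E. Poly_Mapping.keys a \<subseteq> X"
  proof
    fix a assume "a \<in> E"
    then have "(monom_of a :: ('x, 'k) mpoly) \<in> monomials X"
      using G(1) by (auto simp: E_def)
    then show "Poly_Mapping.keys a \<subseteq> X"
      by (simp only: monom_of_in_monomials_iff)
  qed
  ultimately have "antichain_exponents X E"
    by (auto simp: antichain_exponents_def)
  with GE that show thesis by blast
qed

section \<open>The lcm-lattice in terms of exponent vectors\<close>

lemma carrier_lcm_lattice:
  fixes I :: "('x, 'k::field) mpoly set"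
  assumes "finite E" "antichain_exponents X E" "min_gens X I = monom_of ` E"
  shows "carrier (lcm_lattice X I) = (\<lambda>A. monom_of (exponent_lcm A)) ` Pow E"
proof -
  have "monomial_lcms X (monom_of ` A) = {monom_of (exponent_lcm A) :: ('x, 'k) mpoly}" if "A \<subseteq> E" for A
    using that assms(1,2) finite_subset
    by (intro monomial_lcms_eq) (auto simp: antichain_exponents_def)
  then have "(\<Union>A\<in>Pow E. monomial_lcms X (monom_of ` A))
      = (\<Union>A\<in>Pow E. {monom_of (exponent_lcm A) :: ('x, 'k) mpoly})"
    by (intro SUP_cong) auto
  then show ?thesis
    unfolding lcm_lattice_def assms(3) image_Pow_surj[OF refl, symmetric] by auto
qed

lemma le_lcm_lattice:
  fixes I :: "('x, 'k::field) mpoly set"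
  assumes "finite E" "antichain_exponents X E" "B \<subseteq> E"
  shows "monom_of a \<sqsubseteq>\<^bsub>lcm_lattice X I\<^esub> monom_of (exponent_lcm B) \<longleftrightarrow> a \<preceq> exponent_lcm B"
proof -
  have "Poly_Mapping.keys (exponent_lcm B) \<subseteq> X"
    using assms finite_subset by (intro keys_exponent_lcm) (auto simp: antichain_exponents_def)
  then show ?thesis
    by (simp add: lcm_lattice_def monom_of_divides_monom_of)
qed

lemma eq_lcm_lattice: "(.=\<^bsub>lcm_lattice X I\<^esub>) = (=)"
  by (simp add: lcm_lattice_def)

text \<open>
  The join of the lcms of \<open>A\<close> and \<open>B\<close> is the lcm of \<open>A \<union> B\<close>. Their meet need not be the gcd, which
  may fail to be an lcm of generators; it is the lcm of all generators dividing both.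
\<close>

lemma lattice_lcm_lattice:
  fixes I :: "('x, 'k::field) mpoly set"
  assumes E: "finite E" "antichain_exponents X E" "min_gens X I = monom_of ` E"
  shows "lattice (lcm_lattice X I)"
proof -
  let ?L = "lcm_lattice X I"
  let ?u = "\<lambda>A. monom_of (exponent_lcm A) :: ('x, 'k) mpoly"
  note car = carrier_lcm_lattice[OF E]
  note le = le_lcm_lattice[OF E(1,2), where I=I]
  have fin: "finite A" if "A \<subseteq> E" for A using that E(1) finite_subset by blast
  have po: "partial_order ?L"
  proof
    fix x y z
    assume "x \<in> carrier ?L" "y \<in> carrier ?L" "z \<in> carrier ?L" "x \<sqsubseteq>\<^bsub>?L\<^esub> y" "y \<sqsubseteq>\<^bsub>?L\<^esub> z"
    then show "x \<sqsubseteq>\<^bsub>?L\<^esub> z" unfolding car by (auto simp: le intro: exponent_le_trans)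
  qed (auto simp: car le eq_lcm_lattice exponent_le_refl dest: exponent_le_antisym)
  have "\<exists>s. least ?L s (Upper ?L {?u A, ?u B})" if AB: "A \<subseteq> E" "B \<subseteq> E" for A B
  proof (intro exI[of _ "?u (A \<union> B)"])
    have *: "exponent_lcm (A \<union> B) \<preceq> b \<longleftrightarrow> exponent_lcm A \<preceq> b \<and> exponent_lcm B \<preceq> b" for b
      using fin AB by (auto simp: exponent_lcm_le_iff)
    show "least ?L (?u (A \<union> B)) (Upper ?L {?u A, ?u B})"
      using AB fin exponent_le_refl[of "exponent_lcm (A \<union> B)"]
      by (auto simp: least_def Upper_def car le *)
  qed
  moreover have "\<exists>s. greatest ?L s (Lower ?L {?u A, ?u B})" if AB: "A \<subseteq> E" "B \<subseteq> E" for A B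
  proof -
    define C where "C = {a \<in> E. a \<preceq> exponent_lcm A \<and> a \<preceq> exponent_lcm B}"
    have C: "C \<subseteq> E" by (auto simp: C_def)
    have *: "exponent_lcm D \<preceq> exponent_lcm C \<longleftrightarrow> exponent_lcm D \<preceq> exponent_lcm A \<and> exponent_lcm D \<preceq> exponent_lcm B"
      if D: "D \<subseteq> E" for D
    proof
      assume "exponent_lcm D \<preceq> exponent_lcm C"
      moreover have "exponent_lcm C \<preceq> exponent_lcm A" "exponent_lcm C \<preceq> exponent_lcm B"
        using fin[OF C] by (auto simp: exponent_lcm_le_iff C_def)
      ultimately show "exponent_lcm D \<preceq> exponent_lcm A \<and> exponent_lcm D \<preceq> exponent_lcm B"
        using exponent_le_trans by blast
    next
      assume "exponent_lcm D \<preceq> exponent_lcm A \<and> exponent_lcm D \<preceq> exponent_lcm B"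
      then have "D \<subseteq> C" using D fin[OF D] by (auto simp: C_def exponent_lcm_le_iff)
      then show "exponent_lcm D \<preceq> exponent_lcm C"
        using exponent_lcm_mono fin[OF C] by blast
    qed
    have "greatest ?L (?u C) (Lower ?L {?u A, ?u B})"
      using AB C *[OF C] exponent_le_refl[of "exponent_lcm C"]
      by (auto simp: greatest_def Lower_def car le *)
    then show ?thesis ..
  qed
  ultimately show ?thesis
    using po
    by (auto simp: lattice_def upper_semilattice_def lower_semilattice_def car
        upper_semilattice_axioms_def lower_semilattice_axioms_def)
qed

lemma order_isomorphism_imp_lattice_isomorphic:
  assumes L: "lattice L" and M: "lattice M" and bij: "bij_betw f (carrier L) (carrier M)"
    and le: "\<And>x y. x \<in> carrier L \<Longrightarrow> y \<in> carrier L \<Longrightarrow> f x \<sqsubseteq>\<^bsub>M\<^esub> f y \<longleftrightarrow> x \<sqsubseteq>\<^bsub>L\<^esub> y"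
  shows "lattice_isomorphic L M"
proof -
  interpret L: lattice L by fact
  interpret M: lattice M by fact
  have f: "f x \<in> carrier M" if "x \<in> carrier L" for x
    using that bij by (auto simp: bij_betw_def)
  have "f (x \<squnion>\<^bsub>L\<^esub> y) = f x \<squnion>\<^bsub>M\<^esub> f y" if xy: "x \<in> carrier L" "y \<in> carrier L" for x y
  proof (rule M.le_antisym)
    obtain z where z: "z \<in> carrier L" "f z = f x \<squnion>\<^bsub>M\<^esub> f y"
      using bij xy f M.join_closed by (metis bij_betw_imp_surj_on imageE)
    then have "x \<sqsubseteq>\<^bsub>L\<^esub> z" "y \<sqsubseteq>\<^bsub>L\<^esub> z"
      using xy f le[of x z] le[of y z] M.join_left M.join_right by auto
    then have "x \<squnion>\<^bsub>L\<^esub> y \<sqsubseteq>\<^bsub>L\<^esub> z" using xy z L.join_le by blast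
    then show "f (x \<squnion>\<^bsub>L\<^esub> y) \<sqsubseteq>\<^bsub>M\<^esub> f x \<squnion>\<^bsub>M\<^esub> f y"
      using xy z le L.join_closed by metis
    show "f x \<squnion>\<^bsub>M\<^esub> f y \<sqsubseteq>\<^bsub>M\<^esub> f (x \<squnion>\<^bsub>L\<^esub> y)"
      using xy f le L.join_left L.join_right L.join_closed by (intro M.join_le) auto
  qed (use xy f in auto)
  moreover have "f (x \<sqinter>\<^bsub>L\<^esub> y) = f x \<sqinter>\<^bsub>M\<^esub> f y" if xy: "x \<in> carrier L" "y \<in> carrier L" for x y
  proof (rule M.le_antisym)
    obtain z where z: "z \<in> carrier L" "f z = f x \<sqinter>\<^bsub>M\<^esub> f y"
      using bij xy f M.meet_closed by (metis bij_betw_imp_surj_on imageE)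
    then have "z \<sqsubseteq>\<^bsub>L\<^esub> x" "z \<sqsubseteq>\<^bsub>L\<^esub> y"
      using xy f le[of z x] le[of z y] M.meet_left M.meet_right by auto
    then have "z \<sqsubseteq>\<^bsub>L\<^esub> x \<sqinter>\<^bsub>L\<^esub> y" using xy z L.meet_le by blast
    then show "f x \<sqinter>\<^bsub>M\<^esub> f y \<sqsubseteq>\<^bsub>M\<^esub> f (x \<sqinter>\<^bsub>L\<^esub> y)"
      using xy z le L.meet_closed by metis
    show "f (x \<sqinter>\<^bsub>L\<^esub> y) \<sqsubseteq>\<^bsub>M\<^esub> f x \<sqinter>\<^bsub>M\<^esub> f y"
      using xy f le L.meet_left L.meet_right L.meet_closed by (intro M.meet_le) auto
  qed (use xy f in auto)
  ultimately show ?thesis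
    using L M bij unfolding lattice_isomorphic_def join_pres_def meet_pres_def by blast
qed

section \<open>Polarization of exponent vectors\<close>

definition polarize_exponent :: "nat \<Rightarrow> (nat \<Rightarrow>\<^sub>0 nat) \<Rightarrow> nat \<times> nat \<Rightarrow>\<^sub>0 nat" where
  "polarize_exponent n a =
     (\<Sum>p\<in>(SIGMA i:{1..n}. {1..Poly_Mapping.lookup a i}). Poly_Mapping.single p 1)"

lemma lookup_polarize_exponent:
  "Poly_Mapping.lookup (polarize_exponent n a) (i, k) =
     (if i \<in> {1..n} \<and> k \<in> {1..Poly_Mapping.lookup a i} then 1 else 0)"
  by (simp add: polarize_exponent_def lookup_sum lookup_single when_def)

lemma keys_polarize_exponent:
  "Poly_Mapping.keys (polarize_exponent n a) = (SIGMA i:{1..n}. {1..Poly_Mapping.lookup a i})"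
  by (auto simp: in_keys_iff lookup_polarize_exponent split: if_splits)

lemma prod_monom_of:
  "(\<Prod>p\<in>S. monom_of (g p)) = (monom_of (\<Sum>p\<in>S. g p) :: ('x, 'k::field) mpoly)"
  by (induction S rule: infinite_finite_induct) (simp_all add: monom_of_mult, simp_all add: monom_of_def)

lemma polarize_mono_eq_monom_of:
  "polarize_mono n a = (monom_of (polarize_exponent n a) :: (nat \<times> nat, 'k::field) mpoly)"
  by (simp add: polarize_mono_def var_def polarize_exponent_def prod_monom_of sum.Sigma)

text \<open>
  Polarization is monotone because initial segments of different lengths are nested. It reflects the
  order because a nonzero \<open>a\<^sub>i\<close> can be read off from the last variable \<open>(i, a\<^sub>i)\<close> of its segment. The
  assumption on the support of \<open>a\<close> is essential here: coordinates outside \<open>{1..n}\<close> are forgotten.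
\<close>

lemma polarize_exponent_le_iff:
  assumes "Poly_Mapping.keys a \<subseteq> {1..n}"
  shows "polarize_exponent n a \<preceq> polarize_exponent n b \<longleftrightarrow> a \<preceq> b"
proof
  assume le: "polarize_exponent n a \<preceq> polarize_exponent n b"
  have "Poly_Mapping.lookup a i \<le> Poly_Mapping.lookup b i" for i
  proof (cases "Poly_Mapping.lookup a i = 0")
    case False
    then have i: "i \<in> {1..n}" using assms by (meson in_keys_iff subsetD)
    have "Poly_Mapping.lookup (polarize_exponent n a) (i, Poly_Mapping.lookup a i)
        \<le> Poly_Mapping.lookup (polarize_exponent n b) (i, Poly_Mapping.lookup a i)"
      using le by (simp add: exponent_le_def)
    with i False show ?thesis
      by (simp add: lookup_polarize_exponent split: if_splits)
  qed simp
  then show "a \<preceq> b" by (simp add: exponent_le_def)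
next
  assume "a \<preceq> b"
  then show "polarize_exponent n a \<preceq> polarize_exponent n b"
    by (auto simp: exponent_le_def lookup_polarize_exponent intro: le_trans)
qed

text \<open>
  The variable \<open>(i, k)\<close> occurs in the polarized maximum iff \<open>k\<close> is at most the largest \<open>i\<close>-th exponent,
  that is, iff \<open>k \<le> a\<^sub>i\<close> for some \<open>a\<close> in the set. For the nontrivial inequality \<open>k \<ge> 1\<close> guarantees
  that the maximum is attained at such an \<open>a\<close>, and not only at the inserted \<open>0\<close>.
\<close>

lemma polarize_exponent_lcm:
  assumes fin: "finite A" and keys: "\<And>a. a \<in> A \<Longrightarrow> Poly_Mapping.keys a \<subseteq> {1..n}"
  shows "polarize_exponent n (exponent_lcm A) = exponent_lcm (polarize_exponent n ` A)"
proof (rule exponent_le_antisym)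
  show "exponent_lcm (polarize_exponent n ` A) \<preceq> polarize_exponent n (exponent_lcm A)"
    using fin keys by (auto simp: exponent_lcm_le_iff polarize_exponent_le_iff le_exponent_lcm)
next
  have "Poly_Mapping.lookup (polarize_exponent n (exponent_lcm A)) (i, k)
      \<le> Poly_Mapping.lookup (exponent_lcm (polarize_exponent n ` A)) (i, k)" for i k
  proof (cases "i \<in> {1..n} \<and> k \<in> {1..Poly_Mapping.lookup (exponent_lcm A) i}")
    case True
    then have "k \<le> Max (insert 0 ((\<lambda>a. Poly_Mapping.lookup a i) ` A))"
      using fin by (simp add: lookup_exponent_lcm)
    then obtain a where a: "a \<in> A" "k \<le> Poly_Mapping.lookup a i"
      using fin True by (subst (asm) Max_ge_iff) auto
    have "Poly_Mapping.lookup (polarize_exponent n (exponent_lcm A)) (i, k)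
        = Poly_Mapping.lookup (polarize_exponent n a) (i, k)"
      using True a by (simp add: lookup_polarize_exponent)
    also have "\<dots> \<le> Poly_Mapping.lookup (exponent_lcm (polarize_exponent n ` A)) (i, k)"
      using a(1) fin le_exponent_lcm[of "polarize_exponent n ` A" "polarize_exponent n a"]
      by (simp add: exponent_le_def)
    finally show ?thesis .
  qed (auto simp: lookup_polarize_exponent)
  then show "polarize_exponent n (exponent_lcm A) \<preceq> exponent_lcm (polarize_exponent n ` A)"
    by (auto simp: exponent_le_def)
qed

text \<open>
  Finiteness of \<open>E\<close> enters because \<open>max_exponent\<close> bounds the exponents of the generators, and so
  the variables of their polarizations, only if the maximum is taken over a finite set.
\<close>

lemma antichain_polarize_exponents:
  fixes I :: "(nat, 'k::field) mpoly set"
  assumes E: "finite E" "antichain_exponents {1..n} E" "min_gens {1..n} I = monom_of ` E"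
  shows "antichain_exponents (polarization_vars n I) (polarize_exponent n ` E)"
proof -
  have keys: "Poly_Mapping.keys a \<subseteq> {1..n}" if "a \<in> E" for a
    using that E(2) by (auto simp: antichain_exponents_def)
  have "Poly_Mapping.lookup a i \<le> max_exponent n I i" if "a \<in> E" for a i
  proof -
    have "{Poly_Mapping.lookup a i | a. (monom_of a :: (nat, 'k) mpoly) \<in> min_gens {1..n} I}
        = (\<lambda>a. Poly_Mapping.lookup a i) ` E"
      unfolding E(3) by auto
    then show ?thesis
      using that E(1) by (simp add: max_exponent_def)
  qed
  then have "Poly_Mapping.keys (polarize_exponent n a) \<subseteq> polarization_vars n I" if "a \<in> E" for a
    using that by (force simp: keys_polarize_exponent polarization_vars_def intro: le_trans)
  then show ?thesis
    using E(2) keys by (auto simp: antichain_exponents_def polarize_exponent_le_iff)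
qed

theorem lemma3p21:
  fixes n :: nat and I :: "(nat, 'k::field) mpoly set"
  assumes "monomial_ideal {1..n} I"
  shows "lattice_isomorphic (lcm_lattice {1..n} I)
           (lcm_lattice (polarization_vars n I) (polarization n I))"
proof -
  let ?P = "polarize_exponent n"
  let ?X = "polarization_vars n I"
  let ?L = "lcm_lattice {1..n} I" and ?M = "lcm_lattice ?X (polarization n I)"
  obtain E where E: "antichain_exponents {1..n} E" "min_gens {1..n} I = monom_of ` E"
    using min_gens_antichain[OF assms] .
  have fin: "finite E" using finite_antichain_exponents[OF _ E(1)] by simp
  have keys: "Poly_Mapping.keys a \<subseteq> {1..n}" if "a \<in> E" for a
    using that E(1) by (auto simp: antichain_exponents_def)
  note PE = antichain_polarize_exponents[OF fin E]
  have "{polarize_mono n a | a. monom_of a \<in> min_gens {1..n} I}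
      = (monom_of ` ?P ` E :: (nat \<times> nat, 'k) mpoly set)"
    unfolding E(2) polarize_mono_eq_monom_of by auto
  then have gens: "min_gens ?X (polarization n I) = monom_of ` ?P ` E"
    using min_gens_genideal_antichain[OF PE] by (simp add: polarization_def)
  note LE = fin E and ME = finite_imageI[OF fin, of ?P] PE gens
  have lcmP: "exponent_lcm (?P ` A) = ?P (exponent_lcm A)" if "A \<subseteq> E" for A
    using polarize_exponent_lcm[OF finite_subset[OF that fin], of n] keys that by (metis subsetD)
  define f :: "(nat, 'k) mpoly \<Rightarrow> (nat \<times> nat, 'k) mpoly" where
    "f = polarize_mono n \<circ> inv_into UNIV monom_of"
  have inj: "inj (monom_of :: _ \<Rightarrow> (nat, 'k) mpoly)" by (simp add: inj_def)
  have f: "f (monom_of (exponent_lcm A)) = monom_of (exponent_lcm (?P ` A))" if "A \<subseteq> E" for A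
    using lcmP[OF that] by (simp add: f_def inv_f_f[OF inj] polarize_mono_eq_monom_of)
  have le: "f x \<sqsubseteq>\<^bsub>?M\<^esub> f y \<longleftrightarrow> x \<sqsubseteq>\<^bsub>?L\<^esub> y" if xy: "x \<in> carrier ?L" "y \<in> carrier ?L" for x y
  proof -
    obtain A B where AB: "A \<subseteq> E" "B \<subseteq> E" "x = monom_of (exponent_lcm A)" "y = monom_of (exponent_lcm B)"
      using xy unfolding carrier_lcm_lattice[OF LE] by blast
    have "finite A" using AB(1) fin finite_subset by blast
    have "f x \<sqsubseteq>\<^bsub>?M\<^esub> f y \<longleftrightarrow> exponent_lcm (?P ` A) \<preceq> exponent_lcm (?P ` B)"
      unfolding AB(3,4) f[OF AB(1)] f[OF AB(2)] by (rule le_lcm_lattice[OF ME(1,2) image_mono[OF AB(2)]])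
    also have "\<dots> \<longleftrightarrow> ?P (exponent_lcm A) \<preceq> ?P (exponent_lcm B)"
      using AB(1,2) by (simp add: lcmP)
    also have "\<dots> \<longleftrightarrow> exponent_lcm A \<preceq> exponent_lcm B"
      using AB(1) keys \<open>finite A\<close> by (intro polarize_exponent_le_iff keys_exponent_lcm) (blast dest: subsetD)+
    also have "\<dots> \<longleftrightarrow> x \<sqsubseteq>\<^bsub>?L\<^esub> y"
      unfolding AB(3,4) by (rule le_lcm_lattice[OF LE(1,2) AB(2), symmetric])
    finally show ?thesis .
  qed
  have lattices: "lattice ?L" "lattice ?M"
    using lattice_lcm_lattice[OF LE] lattice_lcm_lattice[OF ME] by auto
  interpret L: lattice ?L by (rule lattices)
  have "inj_on f (carrier ?L)"
  proof (rule inj_onI)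
    fix x y assume xy: "x \<in> carrier ?L" "y \<in> carrier ?L" "f x = f y"
    then have "x \<sqsubseteq>\<^bsub>?L\<^esub> y" "y \<sqsubseteq>\<^bsub>?L\<^esub> x"
      using le[of x x] le[of x y] le[of y x] L.le_refl by auto
    then show "x = y" using L.le_antisym xy by blast
  qed
  moreover have "f ` carrier ?L = carrier ?M"
    unfolding carrier_lcm_lattice[OF LE] carrier_lcm_lattice[OF ME]
      image_Pow_surj[OF refl, symmetric]
    by (simp add: image_image f cong: image_cong_simp)
  ultimately have "bij_betw f (carrier ?L) (carrier ?M)"
    by (simp add: bij_betw_def)
  then show ?thesis
    using order_isomorphism_imp_lattice_isomorphic[OF lattices _ le] by blast
qed

end
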